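(* Let $n\ge1$, $n_1=\lceil n/2\rceil$ and $n_2=\lfloor n/2\rfloor$. Then for all $x>0$, $$\sigma_n^{\mathrm H}(x)=x\,\sigma_{n_1}^{\mathrm L^-}(x^2)+x\,\sigma_{n_2}^{\mathrm L^+}(x^2).$$
   Context: For a symmetric probability density $p_n(x_1,\dots,x_n)$ on $\mathbb R^n$ (or $[0,\infty)^n$), the $1$-point correlation function is $\sigma_n(x)=n\int p_n(x,x_2,\dots,x_n)\,dx_2\cdots dx_n$, so that $\frac1n\sigma_n$ is the density of a uniformly chosen one of the $n$ points. $\sigma_n^{\mathrm H}$ is the $1$-point correlation function of the GUE eigenvalue density $p(x_1,\dots,x_n)\propto\prod_{i<j}|x_i-x_j|^2\exp(-\frac12\sum_ix_i^2)$ on $\mathbb R^n$. $\sigma_m^{\mathrm L^-}$ and $\sigma_m^{\mathrm L^+}$ are the $1$-point correlation functions of the Laguerre (LUE) eigenvalue densities $p(x_1,\dots,x_m)\propto\prod_ix_i^{a}\prod_{i<j}|x_i-x_j|^2\exp(-\frac12\sum_ix_i)$ on $[0,\infty)^m$ with $a=-\frac12$ and $a=+\frac12$ respectively; $\sigma_0^{\mathrm L^{+}}=0$ by convention. *)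

theory Defs
  imports "HOL-Analysis.Analysis"
begin

text \<open>
  Points of $R^n$ are functions on the index set \<open>{..<n}\<close>, so the informal
  $x_1, \ldots, x_n$ are \<open>x 0, \<dots>, x (n - 1)\<close>. Densities are taken with respect to
  Lebesgue measure on $R^n$; a density on $[0,\infty)^n$ is extended by zero.
\<close>

abbreviation lebesgue_power :: "nat set \<Rightarrow> (nat \<Rightarrow> real) measure" where
  "lebesgue_power I \<equiv> Pi\<^sub>M I (\<lambda>_. lborel)"

definition normalized_density :: "nat \<Rightarrow> ((nat \<Rightarrow> real) \<Rightarrow> real) \<Rightarrow> (nat \<Rightarrow> real) \<Rightarrow> real" where
  "normalized_density n w x = w x / (\<integral>y. w y \<partial>lebesgue_power {..<n})"

text \<open>The factor \<open>n\<close> makes the correlation function vanish for \<open>n = 0\<close>.\<close>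

definition one_point_correlation :: "nat \<Rightarrow> ((nat \<Rightarrow> real) \<Rightarrow> real) \<Rightarrow> real \<Rightarrow> real" where
  "one_point_correlation n p t = real n * (\<integral>y. p (y(0 := t)) \<partial>lebesgue_power {1..<n})"

definition gue_weight :: "nat \<Rightarrow> (nat \<Rightarrow> real) \<Rightarrow> real" where
  "gue_weight n x =
     (\<Prod>j<n. \<Prod>i<j. \<bar>x i - x j\<bar>\<^sup>2) * exp (- (1 / 2) * (\<Sum>i<n. (x i)\<^sup>2))"

definition lue_weight :: "real \<Rightarrow> nat \<Rightarrow> (nat \<Rightarrow> real) \<Rightarrow> real" where
  "lue_weight a m x =
     (if \<forall>i<m. 0 \<le> x i
      then (\<Prod>i<m. x i powr a) * (\<Prod>j<m. \<Prod>i<j. \<bar>x i - x j\<bar>\<^sup>2) * exp (- (1 / 2) * (\<Sum>i<m. x i))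
      else 0)"

definition gue_density :: "nat \<Rightarrow> (nat \<Rightarrow> real) \<Rightarrow> real" where
  "gue_density n = normalized_density n (gue_weight n)"

definition lue_density :: "real \<Rightarrow> nat \<Rightarrow> (nat \<Rightarrow> real) \<Rightarrow> real" where
  "lue_density a m = normalized_density m (lue_weight a m)"

definition sigma_H :: "nat \<Rightarrow> real \<Rightarrow> real" where
  "sigma_H n = one_point_correlation n (gue_density n)"

definition sigma_L_minus :: "nat \<Rightarrow> real \<Rightarrow> real" where
  "sigma_L_minus m = one_point_correlation m (lue_density (- 1 / 2) m)"

definition sigma_L_plus :: "nat \<Rightarrow> real \<Rightarrow> real" where
  "sigma_L_plus m = one_point_correlation m (lue_density (1 / 2) m)"

end

(* For a weight w with finite moments and monic orthogonal polynomials p_k of squared norm h_k, the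
   Vandermonde determinant equals det (p_j(x_i)); expanding its square and integrating out all but
   one variable leaves sigma_n(t) = w(t) * sum_{k<n} p_k(t)^2 / h_k.  If q_k and r_k are the monic
   orthogonal polynomials for y^(-1/2) e^(-y/2) and y^(1/2) e^(-y/2) on the half line, the
   substitution y = x^2 shows that q_k(x^2) and x r_k(x^2) are those of even and odd degree for
   e^(-x^2/2), with unchanged norms.  Hence the sum for the Gaussian weight splits by parity into
   the two Laguerre sums. *)

theory Submission
  imports Defs "Jordan_Normal_Form.Determinant"
begin

section \<open>The Vandermonde determinant in monic polynomials\<close>

text \<open>Replacing the powers by monic polynomials of the same degrees is a unitriangular change
  of columns, which keeps the Vandermonde value. Leaving \<open>p\<close> free lets orthogonal
  polynomials be inserted later. The induction adds one node at a time and uses interpolation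
  instead of column operations.\<close>

lemma det_monic_polys:
  fixes p :: "nat \<Rightarrow> 'a :: idom poly"
  assumes "\<And>j. j < n \<Longrightarrow> degree (p j) = j" "\<And>j. j < n \<Longrightarrow> lead_coeff (p j) = 1"
  shows "Determinant.det (Matrix.mat n n (\<lambda>(i, j). poly (p j) (x i))) = (\<Prod>j<n. \<Prod>i<j. x j - x i)"
  using assms
proof (induction n)
  case 0
  show ?case by simp
next
  case (Suc n)
  define A where "A t = Matrix.mat (Suc n) (Suc n) (\<lambda>(i, j). poly (p j) ((x(n := t)) i))" for t
  have A_carrier: "A t \<in> carrier_mat (Suc n) (Suc n)" for t
    by (simp add: A_def)
  have IH: "Determinant.det (Matrix.mat n n (\<lambda>(i, j). poly (p j) (x i))) = (\<Prod>j<n. \<Prod>i<j. x j - x i)"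
    using Suc by simp
  show ?case
  \<comment> \<open>If two of the first \<open>n\<close> nodes coincide, both sides vanish;
    otherwise these nodes are the interpolation points.\<close>
  proof (cases "inj_on x {..<n}")
    case False
    then obtain i j where ij: "i < j" "j < n" "x i = x j"
      unfolding inj_on_def by (metis lessThan_iff linorder_neqE_nat)
    have "Determinant.det (A (x n)) = 0"
      by (rule det_identical_rows[OF A_carrier, of i j])
         (use ij in \<open>auto simp: A_def intro!: eq_vecI\<close>)
    moreover have "(\<Prod>j<Suc n. \<Prod>i<j. x j - x i) = 0"
    proof (rule prod_zero)
      show "\<exists>j\<in>{..<Suc n}. (\<Prod>i<j. x j - x i) = 0"
        using ij by (intro bexI[of _ j] prod_zero bexI[of _ i]) auto
    qed simp
    ultimately show ?thesis by (simp add: A_def)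
  next
    case True
    (* As polynomials in the last node, the determinant q and the product r have degree at most n,
       the same coefficient at n, and both vanish at the other n nodes. *)
    define c where "c j = cofactor (A (x n)) n j" for j
    define q where "q = (\<Sum>j<Suc n. Polynomial.smult (c j) (p j))"
    \<comment> \<open>Only row \<open>n\<close> depends on \<open>t\<close>, and deleting it leaves
      cofactors that are constants. Hence expansion along that row is a polynomial in
      \<open>t\<close>.\<close>
    have c_eq: "cofactor (A t) n j = c j" for t j
    proof -
      have "mat_delete (A t) n j = mat_delete (A (x n)) n j"
        by (auto simp: mat_delete_def A_def intro!: eq_matI)
      then show ?thesis by (simp add: c_def cofactor_def)
    qed
    have q_det: "poly q t = Determinant.det (A t)" for t
    proof -
      have "Determinant.det (A t) = (\<Sum>j<Suc n. A t $$ (n, j) * c j)"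
        using laplace_expansion_row[OF A_carrier, of n t] by (simp only: c_eq lessI)
      then show ?thesis by (simp add: q_def poly_sum A_def mult.commute)
    qed
    have c_n: "c n = (\<Prod>j<n. \<Prod>i<j. x j - x i)"
    proof -
      have "mat_delete (A (x n)) n n = Matrix.mat n n (\<lambda>(i, j). poly (p j) (x i))"
        by (auto simp: mat_delete_def A_def intro!: eq_matI)
      then show ?thesis by (simp add: c_def cofactor_def IH)
    qed
    define r where "r = Polynomial.smult (c n) (\<Prod>i<n. [:- x i, 1:])"
    have deg: "degree (\<Prod>i<n. [:- x i, 1:]) = n"
      by (subst degree_prod_sum_eq) auto
    have lead: "coeff (\<Prod>i<n. [:- x i, 1:]) n = 1"
      using lead_coeff_prod[of "\<lambda>i. [:- x i, 1:]" "{..<n}"] deg by simp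
    have "q = r"
    proof (rule poly_eqI_degree_lead_coeff[where n = n and A = "x ` {..<n}"])
      have "coeff (p j) n = 0" if "j < n" for j
        using Suc.prems(1)[of j] that by (simp add: coeff_eq_0)
      moreover have "coeff (p n) n = 1"
        using Suc.prems[of n] by simp
      ultimately show "coeff q n = coeff r n"
        by (simp add: q_def r_def lead coeff_sum)
      show "card (x ` {..<n}) \<ge> n"
        using True by (simp add: card_image)
      show "degree q \<le> n"
        unfolding q_def
        by (intro degree_sum_le) (use Suc.prems(1) in \<open>auto intro!: order.trans[OF degree_smult_le]\<close>)
      show "degree r \<le> n"
        unfolding r_def using deg degree_smult_le by metis
      fix z assume "z \<in> x ` {..<n}"
      then obtain i where i: "i < n" "z = x i" by auto
      have "Determinant.det (A z) = 0"
        by (rule det_identical_rows[OF A_carrier, of i n])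
           (use i in \<open>auto simp: A_def intro!: eq_vecI\<close>)
      moreover have "poly r z = 0"
        using i by (auto simp: r_def poly_prod intro!: disjI2 prod_zero bexI[of _ i])
      ultimately show "poly q z = poly r z" by (simp add: q_det)
    qed
    then have "Determinant.det (A (x n)) = poly r (x n)"
      by (simp add: q_det[symmetric])
    then show ?thesis
      by (simp add: r_def c_n poly_prod A_def)
  qed
qed

section \<open>Correlation functions through orthogonal polynomials\<close>

text \<open>Composition with the transposition of 0 and \<open>i\<close> is a bijection on
  permutations, so position 0 may be traded for any position \<open>i\<close>. Summing over all
  positions turns each permutation's contribution into the full sum of \<open>f\<close>.\<close>

lemma sum_permutations_apply:
  fixes f :: "nat \<Rightarrow> real"
  assumes "0 < n"
  shows "real n * (\<Sum>\<pi> | \<pi> permutes {0..<n}. f (\<pi> 0)) =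
         real (card {\<pi>. \<pi> permutes {0..<n}}) * (\<Sum>k<n. f k)"
proof -
  let ?P = "{\<pi>. \<pi> permutes {0..<n}}"
  have shift: "(\<Sum>\<pi>\<in>?P. f (\<pi> i)) = (\<Sum>\<pi>\<in>?P. f (\<pi> 0))" if "i < n" for i
  proof -
    have tr: "Transposition.transpose 0 i permutes {0..<n}"
      using that assms by (intro permutes_swap_id) auto
    have "(\<Sum>\<pi>\<in>?P. f (\<pi> 0)) = (\<Sum>\<pi>\<in>?P. f ((\<pi> \<circ> Transposition.transpose 0 i) 0))"
      by (rule sum.reindex_bij_witness[where
            i = "\<lambda>\<pi>. \<pi> \<circ> Transposition.transpose 0 i" and j = "\<lambda>\<pi>. \<pi> \<circ> Transposition.transpose 0 i"])
         (auto simp: comp_assoc permutes_compose[OF tr])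
    then show ?thesis by simp
  qed
  have "(\<Sum>i<n. \<Sum>\<pi>\<in>?P. f (\<pi> i)) = (\<Sum>i<n. \<Sum>\<pi>\<in>?P. f (\<pi> 0))"
    by (rule sum.cong[OF refl]) (rule shift, simp)
  then have "real n * (\<Sum>\<pi>\<in>?P. f (\<pi> 0)) = (\<Sum>i<n. \<Sum>\<pi>\<in>?P. f (\<pi> i))"
    by simp
  also have "\<dots> = (\<Sum>\<pi>\<in>?P. \<Sum>i<n. f (\<pi> i))"
    by (rule sum.swap)
  also have "\<dots> = (\<Sum>\<pi>\<in>?P. \<Sum>k<n. f k)"
  proof (rule sum.cong[OF refl])
    fix \<pi> assume "\<pi> \<in> ?P"
    then have "\<pi> permutes {..<n}" by (simp add: lessThan_atLeast0)
    then show "(\<Sum>i<n. f (\<pi> i)) = (\<Sum>k<n. f k)"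
      by (simp add: sum.permute[of \<pi> "{..<n}" f] comp_def)
  qed
  finally show ?thesis by simp
qed

text \<open>Expanding the squared determinant gives a double sum over permutations whose terms
  factor into functions of one variable. Orthogonality in the \<open>n - 1\<close> integrated
  variables already leaves only the diagonal terms, and the same diagonal sum computes the
  normalizing constant.\<close>

lemma one_point_correlation_orthogonal_polys:
  fixes w :: "real \<Rightarrow> real" and p :: "nat \<Rightarrow> real poly" and h :: "nat \<Rightarrow> real"
  assumes int: "\<And>q. integrable lborel (\<lambda>x. poly q x * w x)"
    and deg: "\<And>j. j < n \<Longrightarrow> degree (p j) = j"
    and monic: "\<And>j. j < n \<Longrightarrow> lead_coeff (p j) = 1"
    and orth: "\<And>j k. j < n \<Longrightarrow> k < n \<Longrightarrow>
      (\<integral>x. poly (p j * p k) x * w x \<partial>lborel) = (if j = k then h j else 0)"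
    and h: "\<And>j. j < n \<Longrightarrow> h j \<noteq> 0"
    and W: "\<And>x. W x = (\<Prod>i<n. w (x i)) * (\<Prod>j<n. \<Prod>i<j. \<bar>x i - x j\<bar>\<^sup>2)"
  shows "one_point_correlation n (normalized_density n W) t = w t * (\<Sum>k<n. (poly (p k) t)\<^sup>2 / h k)"
proof (cases "n = 0")
  \<comment> \<open>The prefactor \<open>real n\<close> and the empty sum both give 0. This covers
    \<open>sigma_L_plus 0\<close>, which occurs for one Gaussian eigenvalue.\<close>
  case True
  then show ?thesis by (simp add: one_point_correlation_def)
next
  case False
  then have n: "0 < n" by simp
  interpret product_sigma_finite "\<lambda>_::nat. lborel :: real measure"
    by standard
  define P where "P = {\<pi>. \<pi> permutes {0..<n}}"
  have finP: "finite P" unfolding P_def by (rule finite_permutations) simp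
  have permP: "\<pi> permutes {..<n}" if "\<pi> \<in> P" for \<pi>
    using that by (simp add: P_def lessThan_atLeast0)
  have lt: "\<pi> i < n" if "\<pi> \<in> P" "i < n" for \<pi> i
    using permP[OF that(1)] that(2) permutes_in_image[of \<pi> "{..<n}" i] by simp
  define s :: "(nat \<Rightarrow> nat) \<Rightarrow> real" where "s \<pi> = signof \<pi>" for \<pi>
  have s_sq: "s \<pi> * s \<pi> = 1" for \<pi>
    by (simp add: s_def sign_def)
  \<comment> \<open>The factor carried by variable \<open>i\<close> in the term indexed by
    \<open>\<sigma>\<close> and \<open>\<tau>\<close>.\<close>
  define F where "F \<sigma> \<tau> i u = poly (p (\<sigma> i) * p (\<tau> i)) u * w u" for \<sigma> \<tau> :: "nat \<Rightarrow> nat" and i u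
  define H where "H = (\<Prod>k<n. h k)"
  have H: "H \<noteq> 0" using h by (simp add: H_def)

  have W_eq: "W x = (\<Sum>\<sigma>\<in>P. \<Sum>\<tau>\<in>P. s \<sigma> * s \<tau> * (\<Prod>i<n. F \<sigma> \<tau> i (x i)))" for x
  proof -
    define D where "D = (\<Sum>\<pi>\<in>P. s \<pi> * (\<Prod>i<n. poly (p (\<pi> i)) (x i)))"
    have "(\<Prod>j<n. \<Prod>i<j. x j - x i) =
        Determinant.det (Matrix.mat n n (\<lambda>(i, j). poly (p j) (x i)))"
      using deg monic by (intro det_monic_polys[symmetric]) auto
    also have "\<dots> = D"
      unfolding D_def
      by (subst det_def'[of _ n])
         (auto simp: P_def s_def lessThan_atLeast0 intro!: sum.cong prod.cong)
    finally have "(\<Prod>j<n. \<Prod>i<j. x j - x i) = D" .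
    moreover have "(\<Prod>j<n. \<Prod>i<j. \<bar>x i - x j\<bar>\<^sup>2) = (\<Prod>j<n. \<Prod>i<j. x j - x i)\<^sup>2"
      by (simp add: prod_power_distrib power2_commute)
    ultimately have "W x = (\<Prod>i<n. w (x i)) * D\<^sup>2"
      by (simp add: W)
    also have "\<dots> = (\<Sum>\<sigma>\<in>P. \<Sum>\<tau>\<in>P. s \<sigma> * s \<tau> * (\<Prod>i<n. F \<sigma> \<tau> i (x i)))"
      unfolding D_def power2_eq_square sum_product
      by (simp add: sum_distrib_left F_def prod.distrib mult_ac)
    finally show ?thesis .
  qed

  have intF: "integrable lborel (F \<sigma> \<tau> i)" for \<sigma> \<tau> i
    unfolding F_def by (rule int)
  have I: "(\<integral>u. F \<sigma> \<tau> i u \<partial>lborel) = (if \<sigma> i = \<tau> i then h (\<sigma> i) else 0)"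
    if "\<sigma> \<in> P" "\<tau> \<in> P" "i < n" for \<sigma> \<tau> i
    unfolding F_def by (rule orth[OF lt[OF that(1,3)] lt[OF that(2,3)]])

  \<comment> \<open>Variable 0 is not integrated out in the numerator, so agreement there has to be
    deduced. By surjectivity \<open>\<sigma>\<close> takes the value \<open>\<tau> 0\<close>
    somewhere; if not at 0, then \<open>\<tau>\<close> would take it twice.\<close>
  have eq_iff: "(\<forall>i\<in>{1..<n}. \<sigma> i = \<tau> i) \<longleftrightarrow> \<sigma> = \<tau>" if "\<sigma> \<in> P" "\<tau> \<in> P" for \<sigma> \<tau>
  proof
    assume agree: "\<forall>i\<in>{1..<n}. \<sigma> i = \<tau> i"
    have outside: "\<sigma> i = \<tau> i" if "i \<noteq> 0" for i
    proof (cases "i < n")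
      case True
      then show ?thesis using agree that by auto
    next
      case False
      then show ?thesis
        using permP[OF \<open>\<sigma> \<in> P\<close>] permP[OF \<open>\<tau> \<in> P\<close>] by (simp add: permutes_not_in)
    qed
    have "\<sigma> 0 = \<tau> 0"
    proof (rule ccontr)
      assume neq: "\<sigma> 0 \<noteq> \<tau> 0"
      obtain i where i: "\<sigma> i = \<tau> 0"
        using permP[OF \<open>\<sigma> \<in> P\<close>] by (meson permutes_def)
      with neq have "i \<noteq> 0" by metis
      with outside i have "\<tau> i = \<tau> 0" by simp
      with \<open>i \<noteq> 0\<close> show False
        using permutes_inj[OF permP[OF \<open>\<tau> \<in> P\<close>]] by (auto dest: injD)
    qed
    with outside show "\<sigma> = \<tau>" by (metis ext)
  qed simp

  \<comment> \<open>Over all positions the norms multiply to \<open>H\<close>, by reindexing along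
    \<open>\<sigma>\<close>; dividing by \<open>h (\<sigma> 0)\<close> removes the position that is
    left out.\<close>
  have I_prod: "(\<Prod>i\<in>{1..<n}. \<integral>u. F \<sigma> \<tau> i u \<partial>lborel) = (if \<sigma> = \<tau> then H / h (\<sigma> 0) else 0)"
    if "\<sigma> \<in> P" "\<tau> \<in> P" for \<sigma> \<tau>
  proof (cases "\<sigma> = \<tau>")
    case True
    have "H = (\<Prod>i<n. h (\<sigma> i))"
      unfolding H_def using prod.permute[OF permP[OF that(1)], of h] by (simp add: comp_def)
    also have "{..<n} = insert 0 {1..<n}" using n by auto
    finally have "H = h (\<sigma> 0) * (\<Prod>i\<in>{1..<n}. h (\<sigma> i))" by simp
    moreover have "h (\<sigma> 0) \<noteq> 0" using h lt[OF that(1) n] by simp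
    ultimately show ?thesis using True that by (simp add: I)
  next
    case False
    with eq_iff[OF that] obtain i where "i \<in> {1..<n}" "\<sigma> i \<noteq> \<tau> i" by blast
    then show ?thesis using False that by (auto intro!: prod_zero bexI[of _ i] simp: I)
  qed

  \<comment> \<open>On the diagonal the two signs multiply to 1. The free factor \<open>f\<close> is
    the integral of \<open>F\<close> at position 0 for the normalization, and its value at
    \<open>t\<close> for the numerator.\<close>
  have diag: "(\<Sum>\<sigma>\<in>P. \<Sum>\<tau>\<in>P. s \<sigma> * s \<tau> * (f \<sigma> \<tau> * (if \<sigma> = \<tau> then g \<sigma> else 0))) = (\<Sum>\<sigma>\<in>P. f \<sigma> \<sigma> * g \<sigma>)"
    for f :: "(nat \<Rightarrow> nat) \<Rightarrow> (nat \<Rightarrow> nat) \<Rightarrow> real" and g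
  proof (rule sum.cong[OF refl])
    fix \<sigma> assume "\<sigma> \<in> P"
    have "(\<Sum>\<tau>\<in>P. s \<sigma> * s \<tau> * (f \<sigma> \<tau> * (if \<sigma> = \<tau> then g \<sigma> else 0))) =
          (\<Sum>\<tau>\<in>P. if \<sigma> = \<tau> then f \<sigma> \<sigma> * g \<sigma> else 0)"
      by (rule sum.cong) (auto simp: s_sq)
    then show "(\<Sum>\<tau>\<in>P. s \<sigma> * s \<tau> * (f \<sigma> \<tau> * (if \<sigma> = \<tau> then g \<sigma> else 0))) = f \<sigma> \<sigma> * g \<sigma>"
      using finP \<open>\<sigma> \<in> P\<close> by simp
  qed

  have "(\<integral>y. W y \<partial>lebesgue_power {..<n}) =
        (\<Sum>\<sigma>\<in>P. \<Sum>\<tau>\<in>P. s \<sigma> * s \<tau> * (\<Prod>i<n. \<integral>u. F \<sigma> \<tau> i u \<partial>lborel))"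
    unfolding W_eq
    by (simp add: Bochner_Integration.integral_sum product_integrable_prod product_integral_prod intF)
  \<comment> \<open>Splitting off position 0 makes \<open>I_prod\<close> usable here as well as in
    the numerator.\<close>
  also have "\<dots> = (\<Sum>\<sigma>\<in>P. \<Sum>\<tau>\<in>P. s \<sigma> * s \<tau> * ((\<integral>u. F \<sigma> \<tau> 0 u \<partial>lborel) * (if \<sigma> = \<tau> then H / h (\<sigma> 0) else 0)))"
  proof (intro sum.cong refl arg_cong2[where f = "(*)"])
    fix \<sigma> \<tau> assume st: "\<sigma> \<in> P" "\<tau> \<in> P"
    have "{..<n} = insert 0 {1..<n}" using n by auto
    then show "(\<Prod>i<n. \<integral>u. F \<sigma> \<tau> i u \<partial>lborel) =
        (\<integral>u. F \<sigma> \<tau> 0 u \<partial>lborel) * (if \<sigma> = \<tau> then H / h (\<sigma> 0) else 0)"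
      using I_prod[OF st] by simp
  qed
  also have "\<dots> = (\<Sum>\<sigma>\<in>P. (\<integral>u. F \<sigma> \<sigma> 0 u \<partial>lborel) * (H / h (\<sigma> 0)))"
    by (rule diag)
  also have "\<dots> = (\<Sum>\<sigma>\<in>P. H)"
    by (intro sum.cong refl) (use n h lt in \<open>auto simp: I\<close>)
  finally have Z: "(\<integral>y. W y \<partial>lebesgue_power {..<n}) = real (card P) * H"
    by simp

  have W_upd: "W (y(0 := t)) =
      (\<Sum>\<sigma>\<in>P. \<Sum>\<tau>\<in>P. s \<sigma> * s \<tau> * (F \<sigma> \<tau> 0 t * (\<Prod>i\<in>{1..<n}. F \<sigma> \<tau> i (y i))))" for y
  proof -
    have "{..<n} = insert 0 {1..<n}" using n by auto
    then show ?thesis by (simp add: W_eq)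
  qed
  have "(\<integral>y. W (y(0 := t)) \<partial>lebesgue_power {1..<n}) =
        (\<Sum>\<sigma>\<in>P. \<Sum>\<tau>\<in>P. s \<sigma> * s \<tau> * (F \<sigma> \<tau> 0 t * (\<Prod>i\<in>{1..<n}. \<integral>u. F \<sigma> \<tau> i u \<partial>lborel)))"
    unfolding W_upd
    by (simp add: Bochner_Integration.integral_sum product_integrable_prod product_integral_prod intF
             del: One_nat_def)
  also have "\<dots> = (\<Sum>\<sigma>\<in>P. \<Sum>\<tau>\<in>P. s \<sigma> * s \<tau> * (F \<sigma> \<tau> 0 t * (if \<sigma> = \<tau> then H / h (\<sigma> 0) else 0)))"
    by (intro sum.cong refl) (simp only: I_prod)
  also have "\<dots> = (\<Sum>\<sigma>\<in>P. F \<sigma> \<sigma> 0 t * (H / h (\<sigma> 0)))"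
    by (rule diag)
  also have "\<dots> = H * w t * (\<Sum>\<sigma>\<in>P. (poly (p (\<sigma> 0)) t)\<^sup>2 / h (\<sigma> 0))"
    by (simp add: sum_distrib_left F_def power2_eq_square mult_ac)
  finally have num: "(\<integral>y. W (y(0 := t)) \<partial>lebesgue_power {1..<n}) =
     H * w t * (\<Sum>\<sigma>\<in>P. (poly (p (\<sigma> 0)) t)\<^sup>2 / h (\<sigma> 0))" .

  have cardP: "card P \<noteq> 0"
    using finP permutes_id[of "{0..<n}"] unfolding P_def card_eq_0_iff by blast
  have "one_point_correlation n (normalized_density n W) t =
      w t * (real n * (\<Sum>\<sigma>\<in>P. (poly (p (\<sigma> 0)) t)\<^sup>2 / h (\<sigma> 0))) / real (card P)"
    using H by (simp add: one_point_correlation_def normalized_density_def Z num del: One_nat_def)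
  \<comment> \<open>The factor \<open>n\<close> turns the sum over values at position 0 into
    \<open>card P\<close> copies of the sum over all degrees, and \<open>card P\<close> cancels
    against the normalization.\<close>
  also have "\<dots> = w t * (\<Sum>k<n. (poly (p k) t)\<^sup>2 / h k)"
    using sum_permutations_apply[OF n, of "\<lambda>k. (poly (p k) t)\<^sup>2 / h k"] cardP
    by (simp add: P_def)
  finally show ?thesis .
qed

section \<open>Existence of monic orthogonal polynomials\<close>

text \<open>Gram-Schmidt on the monomials, for an abstract linear functional in place of an
  integral. The condition on \<open>L (p * p)\<close> permits division by the norms in the
  projection coefficients.\<close>

lemma monic_orthogonal_polys_exist:
  fixes L :: "real poly \<Rightarrow> real"
  assumes add: "\<And>p q. L (p + q) = L p + L q"
    and smult: "\<And>c p. L (Polynomial.smult c p) = c * L p"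
    and nondeg: "\<And>p. p \<noteq> 0 \<Longrightarrow> L (p * p) \<noteq> 0"
  shows "\<exists>p. (\<forall>j<n. degree (p j) = j \<and> lead_coeff (p j) = 1) \<and>
             (\<forall>j<n. \<forall>k<n. j \<noteq> k \<longrightarrow> L (p j * p k) = 0)"
proof (induction n)
  case 0
  show ?case by simp
next
  case (Suc n)
  then obtain p where p: "\<And>j. j < n \<Longrightarrow> degree (p j) = j" "\<And>j. j < n \<Longrightarrow> lead_coeff (p j) = 1"
      "\<And>j k. j < n \<Longrightarrow> k < n \<Longrightarrow> j \<noteq> k \<Longrightarrow> L (p j * p k) = 0"
    by blast
  have zero: "L 0 = 0" using smult[of 0 0] by simp
  have sum: "L (\<Sum>j\<in>A. f j) = (\<Sum>j\<in>A. L (f j))" for A :: "nat set" and f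
    by (induction A rule: infinite_finite_induct) (auto simp: zero add)
  have diff: "L (f - g) = L f - L g" for f g
    using add[of "f - g" g] by simp
  define c where "c j = L (monom 1 n * p j) / L (p j * p j)" for j
  define r where "r = (\<Sum>j<n. Polynomial.smult (c j) (p j))"
  define q where "q = monom 1 n - r"
  \<comment> \<open>The correction \<open>r\<close> has no terms of degree \<open>n\<close> or more,
    so \<open>q\<close> stays monic of degree \<open>n\<close>.\<close>
  have coeff_r: "coeff r k = 0" if "k \<ge> n" for k
    unfolding r_def coeff_sum using p(1) that by (intro sum.neutral) (auto simp: coeff_eq_0)
  have "degree q \<le> n"
    by (rule degree_le) (auto simp: q_def coeff_r)
  moreover have coeff_q: "coeff q n = 1"
    by (simp add: q_def coeff_r)
  ultimately have deg_q: "degree q = n"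
    by (metis le_antisym le_degree zero_neq_one)
  have orth_q: "L (q * p k) = 0" if "k < n" for k
  proof -
    have "p k \<noteq> 0" using p(2)[OF that] by auto
    then have nz: "L (p k * p k) \<noteq> 0" by (rule nondeg)
    have "L (r * p k) = (\<Sum>j<n. c j * L (p j * p k))"
      by (simp add: r_def sum_distrib_right sum smult)
    also have "\<dots> = (\<Sum>j<n. if j = k then c k * L (p k * p k) else 0)"
      by (rule sum.cong) (use p(3) that in auto)
    also have "\<dots> = L (monom 1 n * p k)"
      using that nz by (simp add: c_def)
    finally show ?thesis
      by (simp add: q_def left_diff_distrib diff)
  qed
  show ?case
  proof (intro exI[of _ "p(n := q)"] conjI allI impI)
    fix j assume "j < Suc n"
    then show "degree ((p(n := q)) j) = j" "lead_coeff ((p(n := q)) j) = 1"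
      using p deg_q coeff_q by auto
  next
    fix j k assume "j < Suc n" "k < Suc n" "j \<noteq> k"
    then show "L ((p(n := q)) j * (p(n := q)) k) = 0"
      using p(3) orth_q by (auto simp: less_Suc_eq mult.commute)
  qed
qed

section \<open>The substitution y = x^2\<close>

text \<open>On the positive half line the substitution gives the integrand
  \<open>2 * x * G (x\<^sup>2)\<close>. Averaging it with its mirror image spreads the same mass
  evenly over the whole line, where the density is
  \<open>\<bar>x\<bar> * G (x\<^sup>2)\<close>.\<close>

lemma
  fixes G :: "real \<Rightarrow> real"
  assumes G: "integrable lborel G" and G0: "\<And>y. y \<le> 0 \<Longrightarrow> G y = 0"
  shows integrable_abs_times_square: "integrable lborel (\<lambda>x. \<bar>x\<bar> * G (x\<^sup>2))"
    and integral_abs_times_square: "(\<integral>x. \<bar>x\<bar> * G (x\<^sup>2) \<partial>lborel) = (\<integral>y. G y \<partial>lborel)"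
proof -
  have [measurable]: "G \<in> borel_measurable borel"
    using borel_measurable_integrable[OF G] by simp
  define K where "K x = indicator {0<..} x * (2 * x * G (x\<^sup>2))" for x :: real
  have [measurable]: "K \<in> borel_measurable borel"
    unfolding K_def by measurable
  have img: "(\<lambda>x::real. x\<^sup>2) ` {0<..} = {0<..}"
    by (auto intro!: image_eqI[of _ _ "sqrt _"])
  have inj: "inj_on (\<lambda>x::real. x\<^sup>2) {0<..}"
    by (auto simp: inj_on_def)
  have G_ind: "(\<lambda>y. indicator {0<..} y *\<^sub>R G y) = G"
    using G0 by (auto simp: indicator_def fun_eq_iff not_less)
  have "integrable lebesgue G"
    using G by (simp add: integrable_completion)
  \<comment> \<open>The change of variables theorem concerns absolute integrability over a set for
    \<open>lebesgue\<close>, so \<open>G\<close> is moved there from \<open>lborel\<close> and the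
    result is moved back afterwards.\<close>
  then have G_abs: "G absolutely_integrable_on {0<..}"
    unfolding set_integrable_def G_ind .
  have G_val: "integral {0<..} G = (\<integral>y. G y \<partial>lborel)"
    using set_lebesgue_integral_eq_integral(2)[OF G_abs]
    unfolding set_lebesgue_integral_def G_ind by (simp add: integral_completion)
  have "(\<lambda>x. \<bar>2 * x\<bar> * G (x\<^sup>2)) absolutely_integrable_on {0<..} \<and>
      integral {0<..} (\<lambda>x. \<bar>2 * x\<bar> * G (x\<^sup>2)) = (\<integral>y. G y \<partial>lborel)"
    using G_abs G_val
    by (subst has_absolute_integral_change_of_variables_1'[where g = "\<lambda>x. x\<^sup>2"])
       (auto simp: img intro!: derivative_eq_intros inj)
  then have K_abs: "(\<lambda>x. \<bar>2 * x\<bar> * G (x\<^sup>2)) absolutely_integrable_on {0<..}"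
    and K_val: "integral {0<..} (\<lambda>x. \<bar>2 * x\<bar> * G (x\<^sup>2)) = (\<integral>y. G y \<partial>lborel)" by auto
  have K_ind: "(\<lambda>x. indicator {0<..} x *\<^sub>R (\<bar>2 * x\<bar> * G (x\<^sup>2))) = K"
    by (auto simp: K_def indicator_def fun_eq_iff)
  have K_int: "integrable lborel K"
    using K_abs unfolding set_integrable_def K_ind by (simp add: integrable_completion)
  have K_integral: "(\<integral>x. K x \<partial>lborel) = (\<integral>y. G y \<partial>lborel)"
    using set_lebesgue_integral_eq_integral(2)[OF K_abs] K_val
    unfolding set_lebesgue_integral_def K_ind by (simp add: integral_completion)
  have K_int': "integrable lborel (\<lambda>x. K (- x))"
    using lborel_integrable_real_affine[OF K_int, of "-1" 0] by simp
  have K_integral': "(\<integral>x. K (- x) \<partial>lborel) = (\<integral>x. K x \<partial>lborel)"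
    using lborel_integral_real_affine[of "-1" K 0] by simp
  have split: "(\<lambda>x. \<bar>x\<bar> * G (x\<^sup>2)) = (\<lambda>x. (K x + K (- x)) / 2)"
    by (auto simp: K_def indicator_def fun_eq_iff)
  show "integrable lborel (\<lambda>x. \<bar>x\<bar> * G (x\<^sup>2))"
    unfolding split using K_int K_int' by simp
  show "(\<integral>x. \<bar>x\<bar> * G (x\<^sup>2) \<partial>lborel) = (\<integral>y. G y \<partial>lborel)"
    unfolding split using K_int K_int' K_integral K_integral' by simp
qed

section \<open>Laguerre weights on the half line\<close>

text \<open>Extension by zero turns half-line integrals into integrals over \<open>lborel\<close>
  and lets a product of these weights encode the support of \<open>lue_weight\<close>.\<close>

definition laguerre_weight :: "real \<Rightarrow> real \<Rightarrow> real" where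
  "laguerre_weight a y = (if 0 \<le> y then y powr a * exp (- y / 2) else 0)"

(* At y = 0 this uses 0 powr a = 0, whatever the sign of a. *)
lemma laguerre_weight_nonpos: "y \<le> 0 \<Longrightarrow> laguerre_weight a y = 0"
  by (auto simp: laguerre_weight_def)

lemma laguerre_weight_nonneg: "0 \<le> laguerre_weight a y"
  by (simp add: laguerre_weight_def)

lemma borel_measurable_laguerre_weight [measurable]: "laguerre_weight a \<in> borel_measurable borel"
  unfolding laguerre_weight_def by measurable

lemma integrable_laguerre_weight:
  assumes "a > -1"
  shows "integrable lborel (laguerre_weight a)"
proof -
  \<comment> \<open>Euler's Gamma integrand with argument \<open>a + 1\<close> and rate 1/2; on the
    positive half line its norm is the weight itself.\<close>
  let ?f = "\<lambda>t. complex_of_real t powr (of_real (a + 1) - 1) / of_real (exp (1/2 * t))"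
  have "?f absolutely_integrable_on {0<..}"
    using assms by (intro absolutely_integrable_Gamma_integral) auto
  then have "(\<lambda>t. norm (?f t)) absolutely_integrable_on {0<..}"
    by (auto dest: absolutely_integrable_norm simp: comp_def)
  then have "integrable lebesgue (\<lambda>t. indicator {0<..} t *\<^sub>R norm (?f t))"
    by (simp add: set_integrable_def)
  also have "(\<lambda>t. indicator {0<..} t *\<^sub>R norm (?f t)) = laguerre_weight a"
    by (auto simp: fun_eq_iff indicator_def laguerre_weight_def norm_divide norm_powr_real_powr 
                   exp_minus field_simps not_less)
  finally show ?thesis by (simp add: integrable_completion)
qed

lemma integrable_poly_laguerre_weight:
  assumes "a > -1"
  shows "integrable lborel (\<lambda>y. poly q y * laguerre_weight a y)"
proof -
  \<comment> \<open>A power of \<open>y\<close> only raises the parameter, so every moment reduces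
    to integrability of a weight. At \<open>y = 0\<close> both sides are 0.\<close>
  have shift: "y ^ k * laguerre_weight a y = laguerre_weight (a + real k) y" for k y
    by (cases "y = 0") (auto simp: laguerre_weight_def powr_add powr_realpow)
  have "(\<lambda>y. poly q y * laguerre_weight a y) =
      (\<lambda>y. \<Sum>k\<le>degree q. coeff q k * laguerre_weight (a + real k) y)"
    by (simp add: poly_altdef sum_distrib_right mult.assoc shift fun_eq_iff)
  then show ?thesis
    using assms by (auto intro!: Bochner_Integration.integrable_sum integrable_laguerre_weight)
qed

text \<open>The integrand is nonnegative, so a zero integral makes it vanish almost everywhere.
  Since \<open>q\<close> has finitely many roots and the weight is positive on the open unit
  interval, that interval would be null.\<close>

lemma laguerre_square_integral_nonzero:
  assumes "a > -1" "q \<noteq> 0"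
  shows "(\<integral>y. poly (q * q) y * laguerre_weight a y \<partial>lborel) \<noteq> 0"
proof
  assume "(\<integral>y. poly (q * q) y * laguerre_weight a y \<partial>lborel) = 0"
  then have "AE y in lborel. poly (q * q) y * laguerre_weight a y = 0"
    by (rule integral_nonneg_eq_0_iff_AE[THEN iffD1, rotated 2])
       (auto simp: laguerre_weight_nonneg intro!: integrable_poly_laguerre_weight assms simp del: poly_mult,
        simp add: laguerre_weight_nonneg)
  moreover have "AE y in lborel. y \<notin> {y. poly q y = 0}"
    using poly_roots_finite[OF assms(2)]
    by (intro AE_not_in finite_imp_null_set_lborel)
  ultimately have "AE y in lborel. y \<notin> {0<..<1::real}"
    by eventually_elim (auto simp: laguerre_weight_def)
  then have "emeasure lborel {0<..<1::real} = 0"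
    by (subst (asm) AE_iff_null_sets[symmetric]) auto
  then show False by simp
qed

lemma laguerre_orthogonal_polys_exist:
  assumes "a > -1"
  obtains p :: "nat \<Rightarrow> real poly" and h :: "nat \<Rightarrow> real"
  where "\<And>j. j < n \<Longrightarrow> degree (p j) = j" "\<And>j. j < n \<Longrightarrow> lead_coeff (p j) = 1"
    "\<And>j. j < n \<Longrightarrow> h j \<noteq> 0"
    "\<And>j k. j < n \<Longrightarrow> k < n \<Longrightarrow>
      (\<integral>y. poly (p j * p k) y * laguerre_weight a y \<partial>lborel) = (if j = k then h j else 0)"
proof -
  define L where "L q = (\<integral>y. poly q y * laguerre_weight a y \<partial>lborel)" for q
  have "\<exists>p. (\<forall>j<n. degree (p j) = j \<and> lead_coeff (p j) = 1) \<and>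
             (\<forall>j<n. \<forall>k<n. j \<noteq> k \<longrightarrow> L (p j * p k) = 0)"
  proof (rule monic_orthogonal_polys_exist)
    show "L (p + q) = L p + L q" for p q
      using assms by (simp add: L_def ring_distribs integrable_poly_laguerre_weight)
    show "L (Polynomial.smult c p) = c * L p" for c p
      by (simp add: L_def mult.assoc)
    show "L (p * p) \<noteq> 0" if "p \<noteq> 0" for p
      unfolding L_def by (rule laguerre_square_integral_nonzero[OF assms that])
  qed
  then obtain p where p: "\<forall>j<n. degree (p j) = j \<and> lead_coeff (p j) = 1"
    "\<forall>j<n. \<forall>k<n. j \<noteq> k \<longrightarrow> L (p j * p k) = 0" by blast
  have "L (p j * p j) \<noteq> 0" if "j < n" for j
  proof -
    have "p j \<noteq> 0" using p(1) that by force
    then show ?thesis unfolding L_def by (rule laguerre_square_integral_nonzero[OF assms])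
  qed
  with p show ?thesis
    by (intro that[of p "\<lambda>j. L (p j * p j)"]) (auto simp: L_def[symmetric] simp del: poly_mult)
qed

section \<open>The Gaussian weight, its moments and parity\<close>

definition gauss_weight :: "real \<Rightarrow> real" where
  "gauss_weight x = exp (- x\<^sup>2 / 2)"

lemma borel_measurable_gauss_weight [measurable]: "gauss_weight \<in> borel_measurable borel"
  unfolding gauss_weight_def by measurable

text \<open>The Jacobian factor changes the exponent \<open>a\<close> into \<open>2 * a + 1\<close>.
  The parameters -1/2 and 1/2 thus give the Gaussian weight times 1 and times
  \<open>x\<^sup>2\<close>.\<close>

lemma laguerre_weight_square:
  assumes "x \<noteq> 0"
  shows "\<bar>x\<bar> * laguerre_weight a (x\<^sup>2) = \<bar>x\<bar> powr (2 * a + 1) * gauss_weight x"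
proof -
  have "x\<^sup>2 = \<bar>x\<bar> powr 2" using assms by simp
  then have "(x\<^sup>2) powr a = \<bar>x\<bar> powr (2 * a)" by (metis powr_powr)
  then show ?thesis
    using assms by (simp add: laguerre_weight_def gauss_weight_def powr_add)
qed

lemma borel_measurable_poly [measurable (raw)]:
  fixes q :: "real poly"
  assumes "f \<in> borel_measurable M"
  shows "(\<lambda>x. poly q (f x)) \<in> borel_measurable M"
  using measurable_compose[OF assms borel_measurable_continuous_onI[OF continuous_on_poly[OF continuous_on_id]]]
  by simp

lemma AE_lborel_nonzero: "AE x in lborel. x \<noteq> (0::real)"
  by (rule AE_lborel_singleton)

lemma integrable_poly_gauss_weight: "integrable lborel (\<lambda>x. poly q x * gauss_weight x)"
proof -
  have mono: "integrable lborel (\<lambda>x. x ^ k * gauss_weight x)" for k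
  proof -
    \<comment> \<open>Chosen so that \<open>2 * ?a + 1 = k\<close>. It is at least -1/2, hence above
      the integrability threshold -1.\<close>
    let ?a = "(real k - 1) / 2"
    have bound: "integrable lborel (\<lambda>x. \<bar>x\<bar> * laguerre_weight ?a (x\<^sup>2))"
      by (intro integrable_abs_times_square integrable_laguerre_weight laguerre_weight_nonpos) auto
    have le: "AE x in lborel. norm (x ^ k * gauss_weight x) \<le> norm (\<bar>x\<bar> * laguerre_weight ?a (x\<^sup>2))"
      using AE_lborel_nonzero
    proof eventually_elim
      case (elim x)
      have "2 * ?a + 1 = real k" by (simp add: field_simps)
      then have "\<bar>x\<bar> * laguerre_weight ?a (x\<^sup>2) = \<bar>x\<bar> ^ k * gauss_weight x"
        using laguerre_weight_square[OF elim, of ?a] elim by (simp add: powr_realpow)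
      then show ?case by (simp add: abs_mult power_abs)
    qed
    show ?thesis
      by (rule Bochner_Integration.integrable_bound[OF bound _ le]) measurable
  qed
  have "(\<lambda>x. poly q x * gauss_weight x) = (\<lambda>x. \<Sum>k\<le>degree q. coeff q k * (x ^ k * gauss_weight x))"
    by (simp add: poly_altdef sum_distrib_right mult.assoc fun_eq_iff)
  then show ?thesis
    by (auto intro!: Bochner_Integration.integrable_sum mono)
qed

lemma gauss_integral_even:
  "(\<integral>x. poly q (x\<^sup>2) * gauss_weight x \<partial>lborel) = (\<integral>y. poly q y * laguerre_weight (- 1 / 2) y \<partial>lborel)"
proof -
  have "(\<integral>x. poly q (x\<^sup>2) * gauss_weight x \<partial>lborel) =
      (\<integral>x. \<bar>x\<bar> * (poly q (x\<^sup>2) * laguerre_weight (- 1 / 2) (x\<^sup>2)) \<partial>lborel)"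
  proof (rule integral_cong_AE)
    \<comment> \<open>At 0 the right side vanishes while the left side is \<open>poly q 0\<close>,
      so the identity is claimed only almost everywhere.\<close>
    show "AE x in lborel. poly q (x\<^sup>2) * gauss_weight x =
        \<bar>x\<bar> * (poly q (x\<^sup>2) * laguerre_weight (- 1 / 2) (x\<^sup>2))"
      using AE_lborel_nonzero
    proof eventually_elim
      case (elim x)
      then show ?case
        using laguerre_weight_square[OF elim, of "-1/2"] by (simp add: mult.left_commute)
    qed
  qed measurable
  also have "\<dots> = (\<integral>y. poly q y * laguerre_weight (- 1 / 2) y \<partial>lborel)"
    by (rule integral_abs_times_square)
       (auto simp: laguerre_weight_nonpos intro: integrable_poly_laguerre_weight)
  finally show ?thesis .
qed

lemma gauss_integral_square_even:
  "(\<integral>x. x\<^sup>2 * poly q (x\<^sup>2) * gauss_weight x \<partial>lborel) = (\<integral>y. poly q y * laguerre_weight (1 / 2) y \<partial>lborel)"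
proof -
  \<comment> \<open>The factor \<open>x\<^sup>2\<close> makes both sides vanish at 0, so this
    identity holds pointwise.\<close>
  have "x\<^sup>2 * poly q (x\<^sup>2) * gauss_weight x =
      \<bar>x\<bar> * (poly q (x\<^sup>2) * laguerre_weight (1 / 2) (x\<^sup>2))" for x
    using laguerre_weight_square[of x "1/2"] by (cases "x = 0") (auto simp: mult.commute mult.left_commute)
  then have "(\<integral>x. x\<^sup>2 * poly q (x\<^sup>2) * gauss_weight x \<partial>lborel) =
      (\<integral>x. \<bar>x\<bar> * (poly q (x\<^sup>2) * laguerre_weight (1 / 2) (x\<^sup>2)) \<partial>lborel)"
    by (simp only:)
  also have "\<dots> = (\<integral>y. poly q y * laguerre_weight (1 / 2) y \<partial>lborel)"
    by (rule integral_abs_times_square)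
       (auto simp: laguerre_weight_nonpos intro: integrable_poly_laguerre_weight)
  finally show ?thesis .
qed

text \<open>The reflection of \<open>x\<close> to \<open>-x\<close> changes the sign of the
  integrand, so the integral equals its own negative.\<close>

lemma gauss_integral_odd:
  "(\<integral>x. x * poly q (x\<^sup>2) * gauss_weight x \<partial>lborel) = 0"
  using lborel_integral_real_affine[of "-1" "\<lambda>x. x * poly q (x\<^sup>2) * gauss_weight x" 0]
  by (simp add: gauss_weight_def)

section \<open>Both ensembles as product weights times a squared Vandermonde\<close>

lemma gue_weight_eq:
  "gue_weight n x = (\<Prod>i<n. gauss_weight (x i)) * (\<Prod>j<n. \<Prod>i<j. \<bar>x i - x j\<bar>\<^sup>2)"
  by (simp add: gue_weight_def gauss_weight_def exp_sum[symmetric] sum_distrib_left mult.commute)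

text \<open>The support condition passes into the one-variable factors: a negative coordinate makes
  one of them zero.\<close>

lemma lue_weight_eq:
  "lue_weight a m x = (\<Prod>i<m. laguerre_weight a (x i)) * (\<Prod>j<m. \<Prod>i<j. \<bar>x i - x j\<bar>\<^sup>2)"
proof (cases "\<forall>i<m. 0 \<le> x i")
  case True
  have "exp (- (1 / 2) * (\<Sum>i<m. x i)) = (\<Prod>i<m. exp (- x i / 2))"
    by (simp add: exp_sum[symmetric] sum_divide_distrib sum_negf)
  then show ?thesis
    using True by (simp add: lue_weight_def laguerre_weight_def prod.distrib mult_ac)
next
  case False
  then have "(\<Prod>i<m. laguerre_weight a (x i)) = 0"
    by (auto intro!: prod_zero simp: laguerre_weight_def)
  moreover have "lue_weight a m x = 0" using False by (auto simp: lue_weight_def)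
  ultimately show ?thesis by simp
qed

section \<open>Splitting the Gaussian sum by parity\<close>

lemma sum_split_parity:
  fixes f :: "nat \<Rightarrow> 'a :: comm_monoid_add"
  shows "(\<Sum>k<n. f k) = (\<Sum>k<(n + 1) div 2. f (2 * k)) + (\<Sum>k<n div 2. f (2 * k + 1))"
proof (induction n)
  case (Suc n)
  then show ?case
    by (cases "even n") (auto elim!: evenE oddE simp: ac_simps)
qed simp

text \<open>The half indices are written with \<open>div\<close> to suit the parity arguments;
  ceiling and floor enter only in the final theorem.\<close>

lemma one_point_correlation_gue_lue:
  fixes x :: real
  assumes "x > 0"
  shows "sigma_H n x = x * sigma_L_minus ((n + 1) div 2) (x\<^sup>2) + x * sigma_L_plus (n div 2) (x\<^sup>2)"
proof -
  define n1 n2 where "n1 = (n + 1) div 2" and "n2 = n div 2"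
  have a: "- 1 / 2 > (- 1 :: real)" "1 / 2 > (- 1 :: real)" by simp_all
  obtain q hq where
    q: "\<And>j. j < n1 \<Longrightarrow> degree (q j) = j" "\<And>j. j < n1 \<Longrightarrow> lead_coeff (q j) = 1" "\<And>j. j < n1 \<Longrightarrow> hq j \<noteq> 0"
      "\<And>j k. j < n1 \<Longrightarrow> k < n1 \<Longrightarrow>
        (\<integral>y. poly (q j * q k) y * laguerre_weight (- 1 / 2) y \<partial>lborel) = (if j = k then hq j else 0)"
    using laguerre_orthogonal_polys_exist[of "- 1 / 2" n1, OF a(1)] by blast
  obtain r hr where
    r: "\<And>j. j < n2 \<Longrightarrow> degree (r j) = j" "\<And>j. j < n2 \<Longrightarrow> lead_coeff (r j) = 1" "\<And>j. j < n2 \<Longrightarrow> hr j \<noteq> 0"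
      "\<And>j k. j < n2 \<Longrightarrow> k < n2 \<Longrightarrow>
        (\<integral>y. poly (r j * r k) y * laguerre_weight (1 / 2) y \<partial>lborel) = (if j = k then hr j else 0)"
    using laguerre_orthogonal_polys_exist[of "1 / 2" n2, OF a(2)] by blast
  define X2 :: "real poly" where "X2 = [:0, 0, 1:]"
  have X2: "degree X2 = 2" "lead_coeff X2 = 1" "\<And>u. poly X2 u = u\<^sup>2"
    by (simp_all add: X2_def power2_eq_square)
  define P where "P k = (if even k then pcompose (q (k div 2)) X2
      else [:0, 1:] * pcompose (r (k div 2)) X2)" for k
  define h where "h k = (if even k then hq (k div 2) else hr (k div 2))" for k
  have half: "even k \<Longrightarrow> k < n \<Longrightarrow> k div 2 < n1" "odd k \<Longrightarrow> k < n \<Longrightarrow> k div 2 < n2" for k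
    by (auto simp: n1_def n2_def elim!: evenE oddE)
  have P_monic: "degree (P k) = k \<and> lead_coeff (P k) = 1" if "k < n" for k
  proof (cases "even k")
    case True
    then show ?thesis
      using half(1)[OF True that] q X2 lead_coeff_comp[of X2 "q (k div 2)"]
      by (simp add: P_def degree_pcompose)
  next
    case False
    let ?c = "pcompose (r (k div 2)) X2"
    have c: "degree ?c = k - 1" "lead_coeff ?c = 1"
      using half(2)[OF False that] r X2 lead_coeff_comp[of X2 "r (k div 2)"] False
      by (auto simp: degree_pcompose elim!: oddE)
    then have "?c \<noteq> 0" by force
    then have "degree ([:0, 1:] * ?c) = k"
      using c False by (subst degree_mult_eq) (auto elim!: oddE)
    moreover have "lead_coeff ([:0, 1:] * ?c) = 1"
      using c by (subst lead_coeff_mult) simp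
    ultimately show ?thesis using False by (simp add: P_def)
  qed
  have P_poly: "poly (P k) u = (if even k then poly (q (k div 2)) (u\<^sup>2) else u * poly (r (k div 2)) (u\<^sup>2))" for k u
    by (simp add: P_def poly_pcompose X2(3))
  have P_orth: "(\<integral>u. poly (P j * P k) u * gauss_weight u \<partial>lborel) = (if j = k then h j else 0)"
    if "j < n" "k < n" for j k
  proof -
    \<comment> \<open>Equal parities reduce to Laguerre orthogonality under the substitution. Mixed
      parities give an odd integrand and exclude \<open>j = k\<close>, so both sides are 0.\<close>
    consider "even j" "even k" | "odd j" "odd k" | "even j" "odd k" | "odd j" "even k" by blast
    then show ?thesis
    proof cases
      case 1
      have "(\<integral>u. poly (P j * P k) u * gauss_weight u \<partial>lborel) =
          (\<integral>u. poly (q (j div 2) * q (k div 2)) (u\<^sup>2) * gauss_weight u \<partial>lborel)"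
        using 1 by (simp add: P_poly)
      moreover have "j div 2 = k div 2 \<longleftrightarrow> j = k" using 1 by (auto elim!: evenE)
      ultimately show ?thesis
        using 1 q(4)[OF half(1) half(1)] that by (simp add: gauss_integral_even h_def del: poly_mult)
    next
      case 2
      have "(\<integral>u. poly (P j * P k) u * gauss_weight u \<partial>lborel) =
          (\<integral>u. u\<^sup>2 * poly (r (j div 2) * r (k div 2)) (u\<^sup>2) * gauss_weight u \<partial>lborel)"
        using 2 by (simp add: P_poly power2_eq_square mult_ac)
      moreover have "j div 2 = k div 2 \<longleftrightarrow> j = k" using 2 by (auto elim!: oddE)
      ultimately show ?thesis
        using 2 r(4)[OF half(2) half(2)] that by (simp add: gauss_integral_square_even h_def del: poly_mult)
    next
      case 3
      have "(\<integral>u. poly (P j * P k) u * gauss_weight u \<partial>lborel) =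
          (\<integral>u. u * poly (q (j div 2) * r (k div 2)) (u\<^sup>2) * gauss_weight u \<partial>lborel)"
        using 3 by (simp add: P_poly mult_ac)
      then show ?thesis using 3 by (auto simp only: gauss_integral_odd split: if_splits)
    next
      case 4
      have "(\<integral>u. poly (P j * P k) u * gauss_weight u \<partial>lborel) =
          (\<integral>u. u * poly (r (j div 2) * q (k div 2)) (u\<^sup>2) * gauss_weight u \<partial>lborel)"
        using 4 by (simp add: P_poly mult_ac)
      then show ?thesis using 4 by (auto simp only: gauss_integral_odd split: if_splits)
    qed
  qed
  have h: "h k \<noteq> 0" if "k < n" for k
    using half[of k] that q(3) r(3) by (auto simp: h_def)
  have H: "sigma_H n x = gauss_weight x * (\<Sum>k<n. (poly (P k) x)\<^sup>2 / h k)"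
    unfolding sigma_H_def gue_density_def
    by (rule one_point_correlation_orthogonal_polys;
        fact integrable_poly_gauss_weight P_monic[THEN conjunct1] P_monic[THEN conjunct2] P_orth h gue_weight_eq)
  have Lm: "sigma_L_minus n1 (x\<^sup>2) = laguerre_weight (- 1 / 2) (x\<^sup>2) * (\<Sum>k<n1. (poly (q k) (x\<^sup>2))\<^sup>2 / hq k)"
    unfolding sigma_L_minus_def lue_density_def
    by (rule one_point_correlation_orthogonal_polys;
        fact integrable_poly_laguerre_weight[OF a(1)] q lue_weight_eq)
  have Lp: "sigma_L_plus n2 (x\<^sup>2) = laguerre_weight (1 / 2) (x\<^sup>2) * (\<Sum>k<n2. (poly (r k) (x\<^sup>2))\<^sup>2 / hr k)"
    unfolding sigma_L_plus_def lue_density_def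
    by (rule one_point_correlation_orthogonal_polys;
        fact integrable_poly_laguerre_weight[OF a(2)] r lue_weight_eq)
  have "(\<Sum>k<n. (poly (P k) x)\<^sup>2 / h k) =
      (\<Sum>k<n1. (poly (q k) (x\<^sup>2))\<^sup>2 / hq k) + x\<^sup>2 * (\<Sum>k<n2. (poly (r k) (x\<^sup>2))\<^sup>2 / hr k)"
    unfolding sum_split_parity[of _ n] n1_def n2_def
    by (simp add: P_poly h_def power_mult_distrib sum_distrib_left)
  \<comment> \<open>Positivity of \<open>x\<close> removes the absolute values and ensures that
    \<open>x powr 0\<close> is 1. The extra \<open>x\<^sup>2\<close> in the second identity matches
    the squared factor \<open>x\<close> of the odd polynomials.\<close>
  moreover have "x * laguerre_weight (- 1 / 2) (x\<^sup>2) = gauss_weight x"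
    "x * laguerre_weight (1 / 2) (x\<^sup>2) = gauss_weight x * x\<^sup>2"
    using laguerre_weight_square[of x "- 1 / 2"] laguerre_weight_square[of x "1 / 2"] assms by simp_all
  ultimately have "sigma_H n x = x * sigma_L_minus n1 (x\<^sup>2) + x * sigma_L_plus n2 (x\<^sup>2)"
    unfolding H Lm Lp by (simp add: mult.assoc[symmetric] distrib_left)
  then show ?thesis by (simp add: n1_def n2_def)
qed

section \<open>Translation to ceiling and floor\<close>

lemma nat_ceiling_half: "nat \<lceil>real n / 2\<rceil> = (n + 1) div 2"
proof (cases "even n")
  case False
  then obtain m where "n = 2 * m + 1" by (elim oddE)
  moreover have "\<lceil>(2 * real m + 1) / 2\<rceil> = int m + 1"
    by (intro ceiling_unique) auto
  ultimately show ?thesis by (simp add: add.commute)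
qed (auto elim!: evenE)

theorem mainTheorem4:
  fixes n n\<^sub>1 n\<^sub>2 :: nat and x :: real
  assumes "n \<ge> 1"
    and "n\<^sub>1 = nat \<lceil>real n / 2\<rceil>"
    and "n\<^sub>2 = nat \<lfloor>real n / 2\<rfloor>"
    and "x > 0"
  shows "sigma_H n x = x * sigma_L_minus n\<^sub>1 (x\<^sup>2) + x * sigma_L_plus n\<^sub>2 (x\<^sup>2)"
proof -
  have "n\<^sub>2 = n div 2"
    using floor_divide_of_nat_eq[of n 2, where ?'a = real] assms(3) by simp
  then show ?thesis
    using one_point_correlation_gue_lue[OF assms(4)] assms(2) nat_ceiling_half by simp
qed

end
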